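(* Let $\mathbb{F}$ be a field, $\mathsf{R} = \mathbb{F}[x]$, $0\neq h \in \mathsf{R}$ with $h \notin \mathbb{F}^*$, and let $\mathfrak{m} = \mathsf{R}(x-\lambda)$, where $\lambda\in\mathbb{F}$ and $h(\lambda) = 0$. Let $q$ be a fixed element of $\mathsf{R}$. Then for all $n \geq 0$, the module $\mathsf{N}(\mathfrak{m}^{n+1}, q)$ is an indecomposable $\mathsf{A}_h$-module of dimension $n+1$ with a basis $\{v_j \mid j = 0,1,\dots,n\}$ such that for each $j$: (i) $x.v_j = \lambda v_j + v_{j-1}$, where $v_{-1} = 0$; (ii) $y.v_j = q.v_j + (n-j)\,h.v_{j+1} = q.v_j + (n-j)\displaystyle\sum_{\ell=0}^{j} \eta_{j+1-\ell}\, v_\ell$ (for $j=n$ the second term is $0$), where for all $k \geq 0$ $$\eta_k = \begin{cases} \dfrac{h^{(k)}(x)|_{x=\lambda}}{k!} & \text{if } \mathrm{char}(\mathbb{F}) = 0,\\[2mm] \dfrac{h^{[k]}(x)|_{x=\lambda}}{\prod_{i\geq 0} k_i!} & \text{if } \mathrm{char}(\mathbb{F}) = p>0,\end{cases}$$ and where $q.v_j$ is computed by the following formula, valid for any $f \in \mathsf{R}$ (with $v_i = 0$ for $i<0$): $$f.v_j = \begin{cases} \displaystyle\sum_{k\geq 0} \frac{f^{(k)}(x)|_{x=\lambda}}{k!}\, v_{j-k} & \text{if } \mathrm{char}(\mathbb{F}) = 0,\\[2mm] \displaystyle\sum_{k \geq 0} \frac{f^{[k]}(x)|_{x=\lambda}}{\prod_{i\geq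 0} k_i!}\, v_{j-k} & \text{if } \mathrm{char}(\mathbb{F}) = p>0.\end{cases}$$
   Context: $\mathsf{A}_h$ is the unital associative $\mathbb{F}$-algebra with generators $x,y$ and defining relation $yx = xy+h$; throughout $h \ne 0$. Let $\delta:\mathsf{R}\to\mathsf{R}$ be the derivation $\delta(r) = r'h$, where $'$ is the usual derivative with respect to $x$. An ideal $\mathfrak{n}$ of $\mathsf{R}$ is $\delta$-invariant if $\delta(\mathfrak{n})\subseteq\mathfrak{n}$. For a $\delta$-invariant ideal $\mathfrak{n}$ of $\mathsf{R}$ and $q\in\mathsf{R}$, $\mathsf{N}(\mathfrak{n},q)$ is the (left) $\mathsf{A}_h$-module with underlying space $\mathsf{R}/\mathfrak{n}$ and action $s.(r+\mathfrak{n}) = sr+\mathfrak{n}$ for $s,r\in\mathsf{R}$, and $y.(r+\mathfrak{n}) = (qr+\delta(r))+\mathfrak{n}$. (When $h(\lambda)=0$, the ideals $\mathfrak{m}^{n+1}=\mathsf{R}(x-\lambda)^{n+1}$ are $\delta$-invariant.) $f^{(k)}$ denotes the usual $k$th derivative of $f \in\mathbb{F}[x]$, with $f^{(0)}=f$. If $\mathrm{char}(\mathbb{F})=p>0$, write the $p$-adic expansion of an integer $k\ge 0$ as $k=\sum_{i\geq 0} k_i p^i$ with $0\leq k_i<p$, and set $$(x^\ell)^{[k]} = \Big(\prod_{i\geq 0} \ell_i(\ell_i-1)\cdots(\ell_i-k_i+1)\Big)x^{\ell-k},$$ where a factor with $k_i=0$ is interpreted as $1$ (so the coefficient is $0$ when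 $\ell<k$); extend linearly to define $f^{[k]}$ for all $f\in\mathbb{F}[x]$, so $f^{[0]}=f$. *)

theory Defs
  imports
    "HOL-Algebra.Algebraic_Closure_Type"
    "HOL-Algebra.Module"
    "HOL-Library.Poly_Mapping"
begin

subsection \<open>The algebra generated by x and y with the relation yx = xy + h\<close>

datatype gen = GenX | GenY

text \<open>A wrapper around lists, so that words form a monoid under concatenation and
  \<open>word \<Rightarrow>\<^sub>0 'a\<close> with its convolution product is the free associative algebra over \<open>'a\<close>.\<close>

datatype word = Word (letters: "gen list")

instantiation word :: monoid_add
begin

definition zero_word :: word
  where "0 = Word []"

definition plus_word :: "word \<Rightarrow> word \<Rightarrow> word"
  where "u + w = Word (letters u @ letters w)"

instance
  by standard (simp_all add: zero_word_def plus_word_def)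

end

type_synonym 'a free_alg = "word \<Rightarrow>\<^sub>0 'a"

definition free_x :: "'a::field free_alg"
  where "free_x = Poly_Mapping.single (Word [GenX]) 1"

definition free_y :: "'a::field free_alg"
  where "free_y = Poly_Mapping.single (Word [GenY]) 1"

definition free_poly :: "'a::field poly \<Rightarrow> 'a free_alg"
  where "free_poly f = (\<Sum>i\<le>degree f. Poly_Mapping.single 0 (coeff f i) * free_x ^ i)"

definition relation_ideal :: "'a::field poly \<Rightarrow> 'a free_alg set"
  where "relation_ideal h =
    Idl\<^bsub>ring_of_type_algebra\<^esub> {free_y * free_x - (free_x * free_y + free_poly h)}"

definition alg_A :: "'a::field poly \<Rightarrow> 'a free_alg set ring"
  where "alg_A h = ring_of_type_algebra Quot relation_ideal h"

definition class_A :: "'a::field poly \<Rightarrow> 'a free_alg \<Rightarrow> 'a free_alg set"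
  where "class_A h a = relation_ideal h +>\<^bsub>ring_of_type_algebra\<^esub> a"

definition gen_x :: "'a::field poly \<Rightarrow> 'a free_alg set"
  where "gen_x h = class_A h free_x"

definition gen_y :: "'a::field poly \<Rightarrow> 'a free_alg set"
  where "gen_y h = class_A h free_y"

text \<open>The polynomial \<open>f\<close>, read as the element \<open>f(x)\<close> of \<open>alg_A h\<close>.\<close>

definition poly_A :: "'a::field poly \<Rightarrow> 'a poly \<Rightarrow> 'a free_alg set"
  where "poly_A h f = class_A h (free_poly f)"


subsection \<open>Left modules over a possibly non-commutative ring\<close>

text \<open>The library's \<^locale>\<open>module\<close> requires the ring to be commutative.\<close>

locale left_module = R?: ring R + M?: abelian_group M
  for R :: "('a, 'r) ring_scheme" (structure) and M :: "('a, 'b, 'm) module_scheme" (structure) +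
  assumes smult_closed:
      "\<lbrakk>a \<in> carrier R; v \<in> carrier M\<rbrakk> \<Longrightarrow> a \<odot>\<^bsub>M\<^esub> v \<in> carrier M"
    and smult_l_distr:
      "\<lbrakk>a \<in> carrier R; b \<in> carrier R; v \<in> carrier M\<rbrakk> \<Longrightarrow>
        (a \<oplus>\<^bsub>R\<^esub> b) \<odot>\<^bsub>M\<^esub> v = a \<odot>\<^bsub>M\<^esub> v \<oplus>\<^bsub>M\<^esub> b \<odot>\<^bsub>M\<^esub> v"
    and smult_r_distr:
      "\<lbrakk>a \<in> carrier R; v \<in> carrier M; w \<in> carrier M\<rbrakk> \<Longrightarrow>
        a \<odot>\<^bsub>M\<^esub> (v \<oplus>\<^bsub>M\<^esub> w) = a \<odot>\<^bsub>M\<^esub> v \<oplus>\<^bsub>M\<^esub> a \<odot>\<^bsub>M\<^esub> w"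
    and smult_assoc:
      "\<lbrakk>a \<in> carrier R; b \<in> carrier R; v \<in> carrier M\<rbrakk> \<Longrightarrow>
        (a \<otimes>\<^bsub>R\<^esub> b) \<odot>\<^bsub>M\<^esub> v = a \<odot>\<^bsub>M\<^esub> (b \<odot>\<^bsub>M\<^esub> v)"
    and smult_one:
      "v \<in> carrier M \<Longrightarrow> \<one>\<^bsub>R\<^esub> \<odot>\<^bsub>M\<^esub> v = v"

definition indecomposable_module ::
    "('r, 'k) ring_scheme \<Rightarrow> ('r, 'b, 'm) module_scheme \<Rightarrow> bool"
  where "indecomposable_module R M \<longleftrightarrow>
    left_module R M \<and> carrier M \<noteq> {\<zero>\<^bsub>M\<^esub>} \<and>
    (\<forall>U W. submodule U R M \<and> submodule W R M \<and>
        U <+>\<^bsub>M\<^esub> W = carrier M \<and> U \<inter> W = {\<zero>\<^bsub>M\<^esub>} \<longrightarrow>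
      U = {\<zero>\<^bsub>M\<^esub>} \<or> W = {\<zero>\<^bsub>M\<^esub>})"


subsection \<open>The underlying vector space of a module\<close>

definition scale_A ::
    "'a::field poly \<Rightarrow> ('a free_alg set, 'b, 'm) module_scheme \<Rightarrow> 'a \<Rightarrow> 'b \<Rightarrow> 'b"
  where "scale_A h M c v = poly_A h [:c:] \<odot>\<^bsub>M\<^esub> v"

definition lin_indep_A ::
    "'a::field poly \<Rightarrow> ('a free_alg set, 'b, 'm) module_scheme \<Rightarrow> 'b set \<Rightarrow> bool"
  where "lin_indep_A h M B \<longleftrightarrow>
    (\<forall>S c. finite S \<and> S \<subseteq> B \<and> (\<Oplus>\<^bsub>M\<^esub>b\<in>S. scale_A h M (c b) b) = \<zero>\<^bsub>M\<^esub> \<longrightarrow>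
      (\<forall>b\<in>S. c b = 0))"

definition span_A ::
    "'a::field poly \<Rightarrow> ('a free_alg set, 'b, 'm) module_scheme \<Rightarrow> 'b set \<Rightarrow> 'b set"
  where "span_A h M B = {\<Oplus>\<^bsub>M\<^esub>b\<in>S. scale_A h M (c b) b | S c. finite S \<and> S \<subseteq> B}"

definition basis_A ::
    "'a::field poly \<Rightarrow> ('a free_alg set, 'b, 'm) module_scheme \<Rightarrow> 'b set \<Rightarrow> bool"
  where "basis_A h M B \<longleftrightarrow>
    B \<subseteq> carrier M \<and> lin_indep_A h M B \<and> span_A h M B = carrier M"

definition has_dimension_A ::
    "'a::field poly \<Rightarrow> ('a free_alg set, 'b, 'm) module_scheme \<Rightarrow> nat \<Rightarrow> bool"
  where "has_dimension_A h M d \<longleftrightarrow> (\<exists>B. basis_A h M B \<and> finite B \<and> card B = d)"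


subsection \<open>The modules N\<close>

definition delta :: "'a::field poly \<Rightarrow> 'a poly \<Rightarrow> 'a poly"
  where "delta h r = pderiv r * h"

fun gen_act :: "'a::field poly \<Rightarrow> 'a poly \<Rightarrow> gen \<Rightarrow> 'a poly \<Rightarrow> 'a poly"
  where
    "gen_act h q GenX r = [:0, 1:] * r"
  | "gen_act h q GenY r = q * r + delta h r"

definition free_act :: "'a::field poly \<Rightarrow> 'a poly \<Rightarrow> 'a free_alg \<Rightarrow> 'a poly \<Rightarrow> 'a poly"
  where "free_act h q a r =
    (\<Sum>w\<in>Poly_Mapping.keys a.
      Polynomial.smult (Poly_Mapping.lookup a w) (foldr (gen_act h q) (letters w) r))"

text \<open>The action is induced from representatives in the same way as \<^const>\<open>rcoset_mult\<close>; for
  an ideal that is invariant under \<open>delta h\<close> it does not depend on them.\<close>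

definition module_N ::
    "'a::field poly \<Rightarrow> 'a poly set \<Rightarrow> 'a poly \<Rightarrow> ('a free_alg set, 'a poly set) module"
  where "module_N h I q =
    \<lparr>carrier = a_rcosets\<^bsub>ring_of_type_algebra\<^esub> I,
     monoid.mult = rcoset_mult ring_of_type_algebra I,
     one = I +>\<^bsub>ring_of_type_algebra\<^esub> 1,
     zero = I,
     add = set_add ring_of_type_algebra,
     module.smult = (\<lambda>A V. \<Union>a\<in>A. \<Union>r\<in>V. I +>\<^bsub>ring_of_type_algebra\<^esub> free_act h q a r)\<rparr>"


subsection \<open>Taylor coefficients in arbitrary characteristic\<close>

definition digit :: "nat \<Rightarrow> nat \<Rightarrow> nat \<Rightarrow> nat"
  where "digit p k i = k div p ^ i mod p"

definition bracket_deriv :: "nat \<Rightarrow> 'a::field poly \<Rightarrow> 'a poly"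
  where "bracket_deriv k f =
    (\<Sum>l\<le>degree f. monom
      (coeff f l *
        (\<Prod>i\<in>{i. digit CHAR('a) k i \<noteq> 0}.
          \<Prod>t<digit CHAR('a) k i. of_nat (digit CHAR('a) l i) - of_nat t))
      (l - k))"

definition taylor_coeff :: "'a::field \<Rightarrow> 'a poly \<Rightarrow> nat \<Rightarrow> 'a"
  where "taylor_coeff c f k =
    (if CHAR('a) = 0 then poly ((pderiv ^^ k) f) c / of_nat (fact k)
     else poly (bracket_deriv k f) c /
       (\<Prod>i\<in>{i. digit CHAR('a) k i \<noteq> 0}. of_nat (fact (digit CHAR('a) k i))))"

end

theory Submission
  imports Defs
begin

text \<open>
  Put \<open>d = x - c\<close> and \<open>v j = d ^ (n - j)\<close> modulo \<open>d ^ (n + 1)\<close>. In every characteristic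
  \<open>taylor_coeff c f k\<close> is the coefficient of \<open>x ^ k\<close> in \<open>f(x + c)\<close>: in characteristic zero this is
  Taylor's formula, and in characteristic \<open>p\<close> Lucas' theorem identifies the product over the
  \<open>p\<close>-adic digits with a binomial coefficient. So \<open>f\<close> acts on \<open>v j\<close> by its expansion in powers
  of \<open>d\<close>, and the action of \<open>y\<close> is read off from \<open>delta h (d ^ m) = m * d ^ (m - 1) * h\<close>.
  The module is indecomposable since every nonzero submodule contains \<open>v 0\<close>: writing a nonzero
  element as \<open>d ^ m * s\<close> with \<open>s(c) \<noteq> 0\<close> and \<open>m \<le> n\<close>, multiplication by \<open>d ^ (n - m)\<close> gives
  \<open>s(c)\<close> times \<open>v 0\<close>.
\<close>

subsection \<open>Taylor coefficients and Lucas' theorem\<close>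

lemma pderiv_iter_pcompose_shift:
  fixes f :: "'a::field poly"
  shows "(pderiv ^^ k) (pcompose f [:c, 1:]) = pcompose ((pderiv ^^ k) f) [:c, 1:]"
  by (induction k) (simp_all add: pderiv_pcompose pderiv_pCons)

text \<open>Differentiation commutes with the shift by \<open>c\<close>, so evaluation at
  \<open>c\<close> becomes taking a constant coefficient. The factorial stands as a multiplier
  because it may vanish in \<open>'a\<close>.\<close>

lemma coeff_shift_eq_higher_pderiv:
  fixes f :: "'a::field poly"
  shows "of_nat (fact k) * coeff (pcompose f [:c, 1:]) k = poly ((pderiv ^^ k) f) c"
proof -
  have "poly ((pderiv ^^ k) f) c = coeff ((pderiv ^^ k) (pcompose f [:c, 1:])) 0"
    by (simp add: pderiv_iter_pcompose_shift poly_pcompose flip: poly_0_coeff_0)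
  also have "\<dots> = of_nat (fact k) * coeff (pcompose f [:c, 1:]) k"
    by (simp add: coeff_higher_pderiv pochhammer_fact flip: pochhammer_of_nat)
  finally show ?thesis ..
qed

lemma coeff_linear_poly_power_binomial:
  fixes c :: "'a::field"
  shows "coeff ([:c, 1:] ^ l) k = of_nat (l choose k) * c ^ (l - k)"
  by (cases "k \<le> l")
    (simp_all add: coeff_linear_poly_power coeff_eq_0 degree_linear_power binomial_eq_0)

lemma coeff_shift_eq_sum:
  fixes f :: "'a::field poly"
  shows "coeff (pcompose f [:c, 1:]) k =
    (\<Sum>l\<le>degree f. coeff f l * (of_nat (l choose k) * c ^ (l - k)))"
  by (simp add: pcompose_altdef poly_altdef coeff_sum degree_map_poly coeff_map_poly
      coeff_linear_poly_power_binomial)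

text \<open>The step of Lucas' theorem that splits off the lowest digit: compare coefficients in
  \<open>(1 + x) ^ l = ((1 + x) ^ p) ^ (l div p) * (1 + x) ^ (l mod p)\<close>, where
  \<open>(1 + x) ^ p = 1 + x ^ p\<close> by Frobenius.\<close>

lemma binomial_mod_CHAR:
  fixes k l :: nat
  defines "p \<equiv> CHAR('a::field)"
  assumes p: "p > 0"
  shows "(of_nat (l choose k) :: 'a) =
    of_nat (l mod p choose (k mod p)) * of_nat (l div p choose (k div p))"
proof -
  have prime: "prime CHAR('a)"
    using p by (simp add: p_def prime_CHAR_semidom)
  have "[:1, 1:] = 1 + monom (1::'a) 1"
    by (simp add: monom_altdef one_pCons)
  then have frob: "[:1, 1::'a:] ^ p = 1 + monom 1 p"
    using prime by (simp add: freshmans_dream p_def monom_power)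
  have binom: "coeff ([:1, 1::'a:] ^ l) k = of_nat (l choose k)" for l k
    by (simp add: coeff_linear_poly_power_binomial)
  have "[:1, 1::'a:] ^ l = ([:1, 1:] ^ p) ^ (l div p) * [:1, 1:] ^ (l mod p)"
    by (simp flip: power_mult power_add)
  also have "\<dots> = (\<Sum>a\<le>l div p. of_nat (l div p choose a) * monom 1 (p * a)) * [:1, 1:] ^ (l mod p)"
    unfolding frob by (subst add.commute, subst binomial_ring) (simp add: monom_power mult.commute)
  finally have "of_nat (l choose k) =
    coeff (\<Sum>a\<le>l div p. monom (of_nat (l div p choose a)) (p * a) * [:1, 1::'a:] ^ (l mod p)) k"
    unfolding binom[of l k, symmetric]
    by (simp add: sum_distrib_right of_nat_poly smult_monom)
  \<comment> \<open>Only \<open>a = k div p\<close> survives: for smaller \<open>a\<close> the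
    exponent \<open>k - p * a\<close> exceeds the degree \<open>l mod p\<close>, and for larger
    \<open>a\<close> already \<open>p * a\<close> exceeds \<open>k\<close>.\<close>
  also have "\<dots> = (\<Sum>a\<le>l div p. if a = k div p
      then of_nat (l div p choose a) * of_nat (l mod p choose (k mod p)) else 0)"
    unfolding coeff_sum
  proof (rule sum.cong)
    fix a
    show "coeff (monom (of_nat (l div p choose a)) (p * a) * [:1, 1::'a:] ^ (l mod p)) k =
      (if a = k div p then of_nat (l div p choose a) * of_nat (l mod p choose (k mod p)) else 0)"
    proof (cases "p * a \<le> k")
      case True
      then have "a \<le> k div p"
        using p by (simp add: less_eq_div_iff_mult_less_eq mult.commute)
      show ?thesis
      proof (cases "a = k div p")
        case True
        moreover have "\<not> k < p * (k div p)"
          by (simp add: not_less)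
        ultimately show ?thesis
          by (simp add: coeff_monom_mult binom minus_mult_div_eq_mod)
      next
        case False
        with \<open>a \<le> k div p\<close> have "p * (a + 1) \<le> p * (k div p)"
          by (intro mult_left_mono) auto
        also have "\<dots> \<le> k"
          by simp
        finally have "p * a + p \<le> k"
          by simp
        moreover have "l mod p < p"
          using p by simp
        ultimately have "l mod p < k - p * a"
          by linarith
        then show ?thesis
          using False by (simp add: coeff_monom_mult binom binomial_eq_0)
      qed
    next
      case False
      then have "a \<noteq> k div p"
        by auto
      with False show ?thesis
        by (simp add: coeff_monom_mult)
    qed
  qed simp
  also have "\<dots> = of_nat (l mod p choose (k mod p)) * of_nat (l div p choose (k div p))"
    by (auto simp: binomial_eq_0 mult.commute)
  finally show ?thesis .
qed

lemma digit_0: "digit p k 0 = k mod p"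
  by (simp add: digit_def)

lemma digit_Suc: "digit p k (Suc i) = digit p (k div p) i"
  by (simp add: digit_def div_mult2_eq)

lemma digit_eq_0:
  assumes "k < p ^ i"
  shows "digit p k i = 0"
  using assms by (simp add: digit_def)

text \<open>Peel off the lowest digits and recurse on the quotients by \<open>p\<close>. Bounding
  \<open>k\<close> suffices: a digit of \<open>l\<close> beyond position \<open>m\<close> would be
  paired with a zero digit of \<open>k\<close>, giving the factor 1.\<close>

lemma lucas_CHAR:
  fixes k l m :: nat
  assumes p: "CHAR('a::field) > 0" and "k < CHAR('a) ^ m"
  shows "(of_nat (l choose k) :: 'a) =
    (\<Prod>i<m. of_nat (digit CHAR('a) l i choose digit CHAR('a) k i))"
  using assms(2)
proof (induction m arbitrary: k l)
  case 0
  then show ?case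
    by simp
next
  case (Suc m)
  then have "k div CHAR('a) < CHAR('a) ^ m"
    using p by (simp add: div_less_iff_less_mult mult.commute)
  then show ?case
    by (subst binomial_mod_CHAR[OF p])
      (simp add: prod.lessThan_Suc_shift digit_0 digit_Suc Suc.IH del: prod.lessThan_Suc)
qed

text \<open>With truncated subtraction this covers \<open>r > s\<close> too: the factor
  \<open>t = s\<close> is 0.\<close>

lemma prod_diff_eq_binomial_fact: "(\<Prod>t<r. s - t) = (s choose r) * fact r" for r s :: nat
proof (induction r)
  case (Suc r)
  have "(s choose r) * (s - r) = Suc r * (s choose Suc r)"
    by (metis binomial_absorb_comp binomial_absorption mult.commute)
  with Suc show ?case
    by (simp add: algebra_simps)
qed simp

lemma taylor_coeff_eq_coeff_shift:
  "taylor_coeff c f k = coeff (pcompose f [:c, 1:]) k"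
proof (cases "CHAR('a::field) = 0")
  case True
  then have "(of_nat (fact k) :: 'a) \<noteq> 0"
    by (simp add: of_nat_eq_0_iff_char_dvd)
  then show ?thesis
    using True coeff_shift_eq_higher_pderiv[of k f c] by (simp add: taylor_coeff_def field_simps)
next
  case False
  define p where "p = CHAR('a)"
  have prime: "prime p"
    using False by (simp add: p_def prime_CHAR_semidom)
  define D where "D = {i. digit p k i \<noteq> 0}"
  define P where "P = (\<Prod>i\<in>D. of_nat (fact (digit p k i)) :: 'a)"
  define Q where "Q l = (\<Prod>i\<in>D. \<Prod>t<digit p k i. of_nat (digit p l i) - of_nat t :: 'a)" for l
  \<comment> \<open>A crude bound on the number of digits: the nonzero digits of \<open>k\<close>
    sit at positions below \<open>k\<close>, so \<open>D\<close> is finite and Lucas' theorem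
    applies with \<open>k\<close> digits.\<close>
  have "k < p ^ k"
    using prime power_gt_expt[of p k] prime_gt_1_nat[of p] by simp
  have D: "D \<subseteq> {..<k}"
  proof
    fix i
    assume "i \<in> D"
    then have "\<not> k < p ^ i"
      using digit_eq_0 by (auto simp: D_def)
    moreover have "p ^ k \<le> p ^ i" if "k \<le> i"
      using that prime_ge_1_nat[OF prime] by (simp add: power_increasing)
    ultimately show "i \<in> {..<k}"
      using \<open>k < p ^ k\<close> by (meson lessThan_iff not_le order.strict_trans2)
  qed
  \<comment> \<open>Digits are smaller than the prime \<open>p\<close>, which therefore divides none
    of their factorials.\<close>
  have fact_nz: "(of_nat (fact (digit p k i)) :: 'a) \<noteq> 0" for i
    using prime
    by (simp add: of_nat_eq_0_iff_char_dvd flip: p_def)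
      (simp add: prime_dvd_fact_iff digit_def not_le prime_gt_0_nat)
  have P: "P \<noteq> 0"
    using D fact_nz by (auto simp: P_def finite_subset)
  \<comment> \<open>Each inner product is a falling factorial, that is, a binomial coefficient times
    a factorial. The factorials collect into \<open>P\<close>, the denominator of
    \<open>taylor_coeff\<close>, and Lucas' theorem combines the binomials.\<close>
  have Q: "Q l = of_nat (l choose k) * P" for l
  proof -
    have "(\<Prod>t<r. of_nat s - of_nat t :: 'a) = of_nat (s choose r) * of_nat (fact r)" for r s
    proof (cases "r \<le> s")
      case True
      then have "(\<Prod>t<r. of_nat s - of_nat t :: 'a) = of_nat (\<Prod>t<r. s - t)"
        by (simp add: of_nat_diff)
      also have "(\<Prod>t<r. s - t) = (s choose r) * fact r"
        by (rule prod_diff_eq_binomial_fact)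
      finally show ?thesis
        by simp
    next
      case False
      then show ?thesis
        by (force simp: binomial_eq_0)
    qed
    then have "Q l = (\<Prod>i\<in>D. of_nat (digit p l i choose digit p k i)) * P"
      by (simp add: Q_def P_def prod.distrib)
    \<comment> \<open>Outside \<open>D\<close> the digit of \<open>k\<close> is 0, so the added
      factors are 1.\<close>
    also have "(\<Prod>i\<in>D. of_nat (digit p l i choose digit p k i)) =
        (\<Prod>i<k. of_nat (digit p l i choose digit p k i) :: 'a)"
      using D by (intro prod.mono_neutral_left) (auto simp: D_def)
    also have "\<dots> = of_nat (l choose k)"
      using lucas_CHAR[where 'a = 'a, of k k l] \<open>k < p ^ k\<close> False by (simp add: p_def)
    finally show ?thesis .
  qed
  have "poly (bracket_deriv k f) c = (\<Sum>l\<le>degree f. coeff f l * Q l * c ^ (l - k))"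
    by (simp add: bracket_deriv_def poly_sum poly_monom Q_def D_def p_def)
  also have "\<dots> = coeff (pcompose f [:c, 1:]) k * P"
    by (simp add: coeff_shift_eq_sum Q sum_distrib_left mult_ac)
  finally show ?thesis
    using False P by (simp add: taylor_coeff_def P_def D_def p_def)
qed

lemma poly_eq_sum_taylor_coeff:
  "f = (\<Sum>k\<le>degree f. smult (taylor_coeff c f k) ([:- c, 1:] ^ k))"
proof -
  \<comment> \<open>Shift by \<open>c\<close> and back: substituting \<open>x - c\<close> into the
    shifted polynomial sets its coefficients against the powers of \<open>x - c\<close>.\<close>
  have "f = pcompose (pcompose f [:c, 1:]) [:- c, 1:]"
    by (simp add: pcompose_pCons flip: pcompose_assoc)
  also have "\<dots> = (\<Sum>k\<le>degree f. smult (taylor_coeff c f k) ([:- c, 1:] ^ k))"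
    unfolding pcompose_altdef[of _ "[:- c, 1:]"] poly_altdef
    by (simp add: taylor_coeff_eq_coeff_shift degree_pcompose degree_map_poly coeff_map_poly)
  finally show ?thesis .
qed

lemma taylor_coeff_0: "taylor_coeff c f 0 = poly f c"
  by (simp add: taylor_coeff_eq_coeff_shift poly_pcompose flip: poly_0_coeff_0)

text \<open>All discarded terms carry at least the power \<open>Suc j\<close>. This is the precision
  needed for the action on \<open>v j\<close>.\<close>

lemma taylor_remainder_dvd:
  "[:- c, 1:] ^ Suc j dvd f - (\<Sum>k\<le>j. smult (taylor_coeff c f k) ([:- c, 1:] ^ k))"
proof -
  let ?g = "\<lambda>k. smult (taylor_coeff c f k) ([:- c, 1:] ^ k)"
  have "?g k = 0" if "k > degree f" for k
    using that by (simp add: taylor_coeff_eq_coeff_shift coeff_eq_0 degree_pcompose)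
  \<comment> \<open>Since \<open>j\<close> may exceed the degree, both sums are compared inside a
    common range; the added coefficients are zero.\<close>
  then have "(\<Sum>k\<le>degree f. ?g k) = (\<Sum>k\<le>max (degree f) j. ?g k)"
    by (intro sum.mono_neutral_left) (auto simp: not_le)
  then have "f - (\<Sum>k\<le>j. ?g k) = (\<Sum>k\<le>max (degree f) j. ?g k) - (\<Sum>k\<le>j. ?g k)"
    using poly_eq_sum_taylor_coeff[of f c] by simp
  also have "\<dots> = (\<Sum>k\<in>{..max (degree f) j} - {..j}. ?g k)"
    by (subst sum_diff) auto
  also have "[:- c, 1:] ^ Suc j dvd \<dots>"
    by (intro dvd_sum dvd_smult le_imp_power_dvd) auto
  finally show ?thesis .
qed

subsection \<open>Ideals and cosets of a ring given by a type class\<close>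

lemma ring_of_type_algebra_simps [simp]:
  "carrier ring_of_type_algebra = UNIV"
  "x \<oplus>\<^bsub>ring_of_type_algebra\<^esub> y = x + y"
  "x \<otimes>\<^bsub>ring_of_type_algebra\<^esub> y = x * y"
  "\<zero>\<^bsub>ring_of_type_algebra\<^esub> = 0"
  "\<one>\<^bsub>ring_of_type_algebra\<^esub> = 1"
  by (simp_all add: ring_of_type_algebra_def)

lemma ring_ring_of_type_algebra: "ring (ring_of_type_algebra :: 'a::ring_1 ring)"
proof -
  have "\<exists>y. x + y = 0" for x :: 'a
    by (rule exI[of _ "- x"]) simp
  then show ?thesis
    unfolding ring_of_type_algebra_def
    by unfold_locales (auto simp: algebra_simps Units_def)
qed

lemma ring_of_type_algebra_a_inv [simp]:
  "\<ominus>\<^bsub>ring_of_type_algebra\<^esub> x = - (x :: 'a::ring_1)"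
proof -
  interpret ring "ring_of_type_algebra :: 'a ring"
    by (rule ring_ring_of_type_algebra)
  show ?thesis
    by (rule minus_equality) simp_all
qed

lemma ideal_ring_of_type_algebraD:
  fixes I :: "'a::ring_1 set"
  assumes "ideal I ring_of_type_algebra"
  shows "0 \<in> I"
    and "x \<in> I \<Longrightarrow> y \<in> I \<Longrightarrow> x + y \<in> I"
    and "x \<in> I \<Longrightarrow> - x \<in> I"
    and "x \<in> I \<Longrightarrow> y \<in> I \<Longrightarrow> x - y \<in> I"
    and "x \<in> I \<Longrightarrow> z * x \<in> I"
    and "x \<in> I \<Longrightarrow> x * z \<in> I"
proof -
  interpret ideal I ring_of_type_algebra
    by fact
  note sub = additive_subgroup_axioms
  show "0 \<in> I"
    using additive_subgroup.zero_closed[OF sub] by simp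
  show add: "x + y \<in> I" if "x \<in> I" "y \<in> I" for x y
    using additive_subgroup.a_closed[OF sub that] by simp
  show minus: "- x \<in> I" if "x \<in> I" for x
    using additive_subgroup.a_inv_closed[OF sub that] by simp
  show "x - y \<in> I" if "x \<in> I" "y \<in> I"
    using add[OF that(1) minus[OF that(2)]] by simp
  show "z * x \<in> I" "x * z \<in> I" if "x \<in> I"
    using I_l_closed[OF that, of z] I_r_closed[OF that, of z] by simp_all
qed

lemma coset_ring_of_type_algebra_iff:
  fixes I :: "'a::ring_1 set"
  assumes "ideal I ring_of_type_algebra"
  shows "s \<in> I +>\<^bsub>ring_of_type_algebra\<^esub> r \<longleftrightarrow> s - r \<in> I"
  by (auto simp: a_r_coset_def' intro: bexI[of _ "s - r"])

lemma coset_ring_of_type_algebra_eq_iff: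
  fixes I :: "'a::ring_1 set"
  assumes "ideal I ring_of_type_algebra"
  shows "I +>\<^bsub>ring_of_type_algebra\<^esub> r = I +>\<^bsub>ring_of_type_algebra\<^esub> s \<longleftrightarrow> r - s \<in> I"
proof
  assume "I +>\<^bsub>ring_of_type_algebra\<^esub> r = I +>\<^bsub>ring_of_type_algebra\<^esub> s"
  moreover have "r \<in> I +>\<^bsub>ring_of_type_algebra\<^esub> r"
    using ideal_ring_of_type_algebraD(1)[OF assms]
    by (simp add: coset_ring_of_type_algebra_iff[OF assms])
  ultimately show "r - s \<in> I"
    by (simp add: coset_ring_of_type_algebra_iff[OF assms])
next
  assume "r - s \<in> I"
  then have "t - r \<in> I \<longleftrightarrow> t - s \<in> I" for t
    using ideal_ring_of_type_algebraD(2,4)[OF assms, of "t - r" "r - s"]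
      ideal_ring_of_type_algebraD(4)[OF assms, of "t - s" "r - s"]
    by auto
  then show "I +>\<^bsub>ring_of_type_algebra\<^esub> r = I +>\<^bsub>ring_of_type_algebra\<^esub> s"
    by (auto simp: coset_ring_of_type_algebra_iff[OF assms])
qed

subsection \<open>The action of the free algebra and of its quotient\<close>

lemma ideal_relation_ideal: "ideal (relation_ideal h) ring_of_type_algebra"
  unfolding relation_ideal_def
  by (rule ring.genideal_ideal[OF ring_ring_of_type_algebra]) simp

lemma ring_alg_A: "ring (alg_A h)"
  unfolding alg_A_def by (rule ideal.quotient_is_ring[OF ideal_relation_ideal])

lemma carrier_alg_A: "carrier (alg_A h) = range (class_A h)"
  by (auto simp: alg_A_def FactRing_def A_RCOSETS_def' class_A_def)

lemma class_A_hom: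
  "class_A h a \<oplus>\<^bsub>alg_A h\<^esub> class_A h b = class_A h (a + b)"
  "class_A h a \<otimes>\<^bsub>alg_A h\<^esub> class_A h b = class_A h (a * b)"
  "\<one>\<^bsub>alg_A h\<^esub> = class_A h 1"
  using ideal.a_rcos_sum[OF ideal_relation_ideal[of h], of a b]
    ideal.rcoset_mult_add[OF ideal_relation_ideal[of h], of a b]
  by (simp_all add: alg_A_def FactRing_def class_A_def)

lemma foldr_gen_act_add:
  "foldr (gen_act h q) gs (r + s) = foldr (gen_act h q) gs r + foldr (gen_act h q) gs s"
proof (induction gs)
  case (Cons g gs)
  then show ?case
    by (cases g) (simp_all add: delta_def pderiv_add algebra_simps)
qed simp

lemma foldr_gen_act_smult:
  "foldr (gen_act h q) gs (smult c r) = smult c (foldr (gen_act h q) gs r)"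
proof (induction gs)
  case (Cons g gs)
  then show ?case
    by (cases g) (simp_all add: delta_def pderiv_smult smult_add_right)
qed simp

lemma free_act_eq_sum:
  assumes "finite S" and "Poly_Mapping.keys a \<subseteq> S"
  shows "free_act h q a r =
    (\<Sum>w\<in>S. smult (Poly_Mapping.lookup a w) (foldr (gen_act h q) (letters w) r))"
  unfolding free_act_def using assms
  by (intro sum.mono_neutral_left) (auto simp: in_keys_iff)

lemma free_act_single [simp]:
  "free_act h q (Poly_Mapping.single w c) r = smult c (foldr (gen_act h q) (letters w) r)"
  by (subst free_act_eq_sum[of "{w}"]) auto

lemma free_act_zero [simp]: "free_act h q 0 r = 0"
  by (simp add: free_act_def)

lemma free_act_add [simp]: "free_act h q (a + b) r = free_act h q a r + free_act h q b r"
proof -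
  let ?S = "Poly_Mapping.keys a \<union> Poly_Mapping.keys b"
  have "Poly_Mapping.keys (a + b) \<subseteq> ?S"
    by (rule keys_add)
  then show ?thesis
    by (simp add: free_act_eq_sum[of ?S] lookup_add smult_add_left sum.distrib)
qed

lemma free_act_sum: "free_act h q (\<Sum>i\<in>S. a i) r = (\<Sum>i\<in>S. free_act h q (a i) r)"
  by (induction S rule: infinite_finite_induct) simp_all

lemma free_act_uminus [simp]: "free_act h q (- a) r = - free_act h q a r"
  using free_act_add[of h q a "- a" r] by (simp add: eq_neg_iff_add_eq_0 add.commute)

lemma free_act_diff [simp]: "free_act h q (a - b) r = free_act h q a r - free_act h q b r"
  using free_act_add[of h q a "- b" r] by simp

lemma free_act_add_right:
  "free_act h q a (r + s) = free_act h q a r + free_act h q a s"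
  by (simp add: free_act_def foldr_gen_act_add smult_add_right sum.distrib)

lemma free_act_smult_right: "free_act h q a (smult c r) = smult c (free_act h q a r)"
  by (simp add: free_act_def foldr_gen_act_smult mult.commute sum_distrib_left[of "[:c:]", simplified])

lemma free_act_zero_right [simp]: "free_act h q a 0 = 0"
  using free_act_smult_right[of h q a 0 0] by simp

lemma poly_mapping_eq_sum_single:
  "a = (\<Sum>w\<in>Poly_Mapping.keys a. Poly_Mapping.single w (Poly_Mapping.lookup a w))"
  by (rule poly_mapping_eqI)
    (simp add: lookup_sum lookup_single when_def in_keys_iff)

text \<open>By linearity this reduces to single words, where concatenation of words is composition
  of folds.\<close>

lemma free_act_mult [simp]: "free_act h q (a * b) r = free_act h q a (free_act h q b r)"
proof -
  have single: "free_act h q (Poly_Mapping.single v c * b) r =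
      free_act h q (Poly_Mapping.single v c) (free_act h q b r)" for v c
  proof -
    have "free_act h q (Poly_Mapping.single v c * b) r =
        (\<Sum>w\<in>Poly_Mapping.keys b. free_act h q
          (Poly_Mapping.single v c * Poly_Mapping.single w (Poly_Mapping.lookup b w)) r)"
      by (subst (1) poly_mapping_eq_sum_single[of b]) (simp add: sum_distrib_left free_act_sum)
    also have "\<dots> = (\<Sum>w\<in>Poly_Mapping.keys b. free_act h q (Poly_Mapping.single v c)
        (free_act h q (Poly_Mapping.single w (Poly_Mapping.lookup b w)) r))"
      by (simp add: mult_single plus_word_def foldr_gen_act_smult)
    also have "\<dots> = free_act h q (Poly_Mapping.single v c)
        (\<Sum>w\<in>Poly_Mapping.keys b. free_act h q (Poly_Mapping.single w (Poly_Mapping.lookup b w)) r)"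
      by (induction rule: infinite_finite_induct) (simp_all add: free_act_add_right del: free_act_single)
    also have "\<dots> = free_act h q (Poly_Mapping.single v c) (free_act h q b r)"
      by (simp add: free_act_def[of h q b])
    finally show ?thesis .
  qed
  show ?thesis
    by (subst (1) poly_mapping_eq_sum_single[of a])
      (simp add: sum_distrib_right free_act_sum single free_act_def[of h q a])
qed

lemma free_act_one [simp]: "free_act h q 1 r = r"
  by (simp add: zero_word_def flip: single_one)

lemma free_act_free_x [simp]: "free_act h q free_x r = [:0, 1:] * r"
  by (simp add: free_x_def)

lemma free_act_free_y [simp]: "free_act h q free_y r = q * r + delta h r"
  by (simp add: free_y_def)

lemma free_act_free_poly [simp]: "free_act h q (free_poly f) r = f * r"
proof -
  have pow: "free_act h q (free_x ^ i) r = [:0, 1:] ^ i * r" for i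
    by (induction i) (simp_all add: mult.assoc)
  have "free_act h q (free_poly f) r = (\<Sum>i\<le>degree f. smult (coeff f i) ([:0, 1:] ^ i)) * r"
    by (simp add: free_poly_def free_act_sum pow sum_distrib_right zero_word_def)
  also have "(\<Sum>i\<le>degree f. smult (coeff f i) ([:0, 1:] ^ i)) = f"
    by (simp add: poly_as_sum_of_monoms flip: monom_altdef)
  finally show ?thesis .
qed

text \<open>The elements acting as zero form a two-sided ideal, so it is enough to check the
  defining relation.\<close>

lemma free_act_relation_ideal:
  fixes h :: "'a::field poly"
  assumes "a \<in> relation_ideal h"
  shows "free_act h q a r = 0"
proof -
  \<comment> \<open>Quantifying over all \<open>r\<close> gives closure under right multiplication,
    where \<open>a\<close> is applied to another polynomial.\<close>
  let ?K = "{a. \<forall>r. free_act h q a r = 0}"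
  have "ideal ?K ring_of_type_algebra"
  proof (rule idealI)
    have "inv\<^bsub>add_monoid ring_of_type_algebra\<^esub> a = - a" for a :: "'a free_alg"
      using ring_of_type_algebra_a_inv[of a] by (simp only: a_inv_def)
    then show "subgroup ?K (add_monoid ring_of_type_algebra)"
      by (intro subgroup.intro) auto
  qed (simp_all add: ring_ring_of_type_algebra)
  \<comment> \<open>By the product rule, \<open>delta h (x * r) = x * delta h r + h * r\<close>,
    while multiplication by \<open>q\<close> commutes with \<open>x\<close>.\<close>
  moreover have "free_y * free_x - (free_x * free_y + free_poly h) \<in> ?K"
    by (simp add: delta_def pderiv_mult pderiv_pCons algebra_simps)
  ultimately have "relation_ideal h \<subseteq> ?K"
    unfolding relation_ideal_def
    by (intro ring.genideal_minimal ring_ring_of_type_algebra) simp_all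
  with assms show ?thesis
    by auto
qed

subsection \<open>The module structure on the quotient by an invariant ideal\<close>

locale invariant_ideal =
  fixes h q :: "'a::field poly" and I :: "'a poly set"
  assumes ideal: "ideal I ring_of_type_algebra"
    and delta_mem: "r \<in> I \<Longrightarrow> delta h r \<in> I"
begin

abbreviation N :: "('a free_alg set, 'a poly set) module"
  where "N \<equiv> module_N h I q"

abbreviation coset :: "'a poly \<Rightarrow> 'a poly set"
  where "coset r \<equiv> I +>\<^bsub>ring_of_type_algebra\<^esub> r"

lemmas I_closed = ideal_ring_of_type_algebraD[OF ideal]

lemmas coset_iff = coset_ring_of_type_algebra_iff[OF ideal]

lemmas coset_eq_iff = coset_ring_of_type_algebra_eq_iff[OF ideal]

lemma carrier_N: "carrier N = range coset"
  by (auto simp: module_N_def A_RCOSETS_def')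

lemma coset_in_N [simp]: "coset r \<in> carrier N"
  by (simp add: carrier_N)

lemma zero_N: "\<zero>\<^bsub>N\<^esub> = coset 0"
  by (auto simp: module_N_def coset_iff)

lemma add_N [simp]: "coset r \<oplus>\<^bsub>N\<^esub> coset s = coset (r + s)"
  using ideal.a_rcos_sum[OF ideal, of r s] by (simp add: module_N_def)

text \<open>Each generator preserves \<open>I\<close>, \<open>GenY\<close> because of
  \<open>delta_mem\<close>; hence so do words and their linear combinations.\<close>

lemma free_act_mem:
  assumes "r \<in> I"
  shows "free_act h q a r \<in> I"
proof -
  have "foldr (gen_act h q) gs r \<in> I" for gs
  proof (induction gs)
    case (Cons g gs)
    then show ?case
      using I_closed(5)[of "foldr (gen_act h q) gs r" "[:0, 1:]"]
      by (cases g) (auto intro: I_closed delta_mem)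
  qed (simp add: assms)
  then have "smult c (foldr (gen_act h q) gs r) \<in> I" for c gs
    using I_closed(5)[of "foldr (gen_act h q) gs r" "[:c:]"] by simp
  then have "(\<Sum>w\<in>S. smult (Poly_Mapping.lookup a w) (foldr (gen_act h q) (letters w) r)) \<in> I" for S
    by (induction S rule: infinite_finite_induct) (auto intro: I_closed)
  then show ?thesis
    by (simp add: free_act_def)
qed

text \<open>This is well-definedness of the action. Another representative of the class differs by
  an element that acts as zero, another representative of the coset by an element that stays in
  \<open>I\<close>; so the union in \<open>module_N\<close> is over copies of one coset.\<close>

lemma smult_N [simp]: "class_A h a \<odot>\<^bsub>N\<^esub> coset r = coset (free_act h q a r)"
proof -
  have eq: "coset (free_act h q b s) = coset (free_act h q a r)"
    if "b \<in> class_A h a" and "s \<in> coset r" for b s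
  proof -
    have "b - a \<in> relation_ideal h"
      using that(1) by (simp add: class_A_def coset_ring_of_type_algebra_iff[OF ideal_relation_ideal])
    from free_act_relation_ideal[OF this] have "free_act h q b s = free_act h q a s"
      by simp
    moreover have "free_act h q a s - free_act h q a r = free_act h q a (s - r)"
      using free_act_add_right[of h q a "s - r" r] by simp
    ultimately show ?thesis
      using that(2) by (simp add: coset_eq_iff coset_iff free_act_mem)
  qed
  have "a \<in> class_A h a"
    using ideal_ring_of_type_algebraD(1)[OF ideal_relation_ideal]
    by (simp add: class_A_def coset_ring_of_type_algebra_iff[OF ideal_relation_ideal])
  then have ne: "class_A h a \<noteq> {}"
    by blast
  have "r \<in> coset r"
    by (simp add: coset_iff I_closed)
  then have ne': "coset r \<noteq> {}"
    by blast
  have "class_A h a \<odot>\<^bsub>N\<^esub> coset r = (\<Union>b\<in>class_A h a. \<Union>s\<in>coset r. coset (free_act h q b s))"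
    by (simp add: module_N_def)
  also have "\<dots> = (\<Union>b\<in>class_A h a. \<Union>s\<in>coset r. coset (free_act h q a r))"
    by (intro SUP_cong refl eq)
  also have "\<dots> = coset (free_act h q a r)"
    using ne ne' by simp
  finally show ?thesis .
qed

lemma abelian_group_N: "abelian_group N"
proof (rule abelian_groupI)
  fix w
  assume "w \<in> carrier N"
  then obtain r where "w = coset r"
    by (auto simp: carrier_N)
  then show "\<exists>u\<in>carrier N. u \<oplus>\<^bsub>N\<^esub> w = \<zero>\<^bsub>N\<^esub>"
    by (intro bexI[of _ "coset (- r)"]) (simp_all add: zero_N)
qed (auto simp: carrier_N zero_N add_ac)

sublocale N: abelian_group N
  by (rule abelian_group_N)

lemma left_module_N: "left_module (alg_A h) N"
proof (intro left_module.intro left_module_axioms.intro)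
  show "ring (alg_A h)"
    by (rule ring_alg_A)
  show "abelian_group N"
    by (rule abelian_group_N)
qed (auto simp: carrier_alg_A carrier_N class_A_hom free_act_add_right)

lemma finsum_N [simp]: "finite S \<Longrightarrow> (\<Oplus>\<^bsub>N\<^esub>i\<in>S. coset (f i)) = coset (\<Sum>i\<in>S. f i)"
  by (induction S rule: finite_induct) (simp_all add: zero_N N.finsum_insert)

lemma scale_N [simp]: "scale_A h N c (coset r) = coset (smult c r)"
  by (simp add: scale_A_def poly_A_def)

end

subsection \<open>The ideal generated by a power of a linear factor of h\<close>

locale linear_power_ideal =
  fixes h q :: "'a::field poly" and c :: 'a and n :: nat
  assumes root: "poly h c = 0"
begin

definition d :: "'a poly"
  where "d = [:- c, 1:]"

lemma degree_d_power [simp]: "degree (d ^ i) = i"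
  by (simp add: d_def degree_linear_power)

lemma pderiv_d [simp]: "pderiv d = 1"
  by (simp add: d_def pderiv_pCons)

lemma d_nonzero [simp]: "d \<noteq> 0"
  by (simp add: d_def)

lemma d_dvd_iff: "d dvd f \<longleftrightarrow> poly f c = 0"
  by (simp add: d_def poly_eq_0_iff_dvd)

definition I :: "'a poly set"
  where "I = PIdl\<^bsub>ring_of_type_algebra\<^esub> (d ^ (n + 1))"

lemma mem_I_iff: "r \<in> I \<longleftrightarrow> d ^ (n + 1) dvd r"
  by (auto simp: I_def cgenideal_def dvd_def mult.commute)

sublocale invariant_ideal h q I
proof (rule invariant_ideal.intro)
  show "ideal I ring_of_type_algebra"
    unfolding I_def by (rule cring.cgenideal_ideal[OF cring_from_type_algebra]) simp
next
  fix r
  assume "r \<in> I"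
  then obtain s where r: "r = d ^ Suc n * s"
    by (auto simp: mem_I_iff elim: dvdE)
  \<comment> \<open>Differentiation loses one factor \<open>d\<close>; the root \<open>c\<close> of
    \<open>h\<close> restores it.\<close>
  have "d ^ n dvd pderiv r"
    unfolding r pderiv_mult pderiv_power_Suc by (auto intro!: dvd_add dvd_smult)
  moreover have "d dvd h"
    using root by (simp add: d_dvd_iff)
  ultimately have "d ^ n * d dvd pderiv r * h"
    by (rule mult_dvd_mono)
  then show "delta h r \<in> I"
    by (simp add: mem_I_iff delta_def mult.commute)
qed

text \<open>The exponents are reversed so that multiplication by \<open>d\<close> lowers the index.
  Truncated subtraction makes \<open>v (n + 1)\<close> the class of 1; in \<open>gen_y_v\<close>
  with \<open>j = n\<close> it occurs with scalar 0.\<close>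

definition v :: "nat \<Rightarrow> 'a poly set"
  where "v j = coset (d ^ (n - j))"

section \<open>Basis and dimension\<close>

lemma combination_mem_I:
  assumes "(\<Sum>j\<le>n. smult (a j) (d ^ (n - j))) \<in> I" and "j \<le> n"
  shows "a j = 0"
proof -
  let ?s = "\<Sum>j\<le>n. smult (a j) (d ^ (n - j))"
  \<comment> \<open>A polynomial of degree at most \<open>n\<close> that is divisible by
    \<open>d ^ (n + 1)\<close> is zero.\<close>
  have "degree ?s \<le> n"
    by (intro degree_sum_le order.trans[OF degree_smult_le]) auto
  then have "?s = 0"
    using assms(1) dvd_imp_degree_le[of "d ^ (n + 1)" ?s]
    unfolding mem_I_iff degree_d_power by linarith
  \<comment> \<open>The shift by \<open>c\<close> turns powers of \<open>d\<close> into monomials,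
    so the \<open>a j\<close> can be read off as coefficients.\<close>
  then have "0 = pcompose ?s [:c, 1:]"
    by simp
  also have "\<dots> = (\<Sum>j\<le>n. monom (a j) (n - j))"
  proof -
    have "pcompose d [:c, 1:] = [:0, 1:]"
      by (simp add: d_def pcompose_pCons)
    then have "pcompose (d ^ i) [:c, 1:] = monom 1 i" for i
      by (induction i) (simp_all add: pcompose_mult pcompose_1 monom_altdef)
    then show ?thesis
      by (simp add: pcompose_sum pcompose_smult smult_monom)
  qed
  finally have "0 = coeff (\<Sum>j\<le>n. monom (a j) (n - j)) (n - j)"
    by simp
  also have "\<dots> = (\<Sum>i\<le>n. if i = j then a i else 0)"
    unfolding coeff_sum using assms(2) by (intro sum.cong) auto
  also have "\<dots> = a j"
    using assms(2) by simp
  finally show ?thesis ..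
qed

lemma inj_v: "inj_on v {..n}"
proof (rule inj_onI)
  fix i j
  assume ij: "i \<in> {..n}" "j \<in> {..n}" "v i = v j"
  \<comment> \<open>The coefficients of \<open>d ^ (n - i) - d ^ (n - j)\<close>; the one at
    \<open>i\<close> vanishes only if \<open>i = j\<close>.\<close>
  let ?a = "\<lambda>l. of_bool (l = i) - of_bool (l = j) :: 'a"
  have "(\<Sum>l\<le>n. smult (?a l) (d ^ (n - l))) = d ^ (n - i) - d ^ (n - j)"
    using ij(1,2) by (simp add: smult_diff_left sum_subtractf of_bool_def if_distrib[of "\<lambda>x. smult x _"] cong: if_cong)
  moreover have "\<dots> \<in> I"
    using ij(3) by (simp add: v_def coset_eq_iff)
  ultimately have "?a i = 0"
    using combination_mem_I[of ?a i] ij(1) by simp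
  then show "i = j"
    by (auto split: if_splits)
qed

lemma poly_A_v: "poly_A h f \<odot>\<^bsub>N\<^esub> v j = coset (f * d ^ (n - j))"
  by (simp add: poly_A_def v_def)

text \<open>The Taylor expansion may be cut after \<open>d ^ j\<close>: the remainder is a multiple
  of \<open>d ^ (j + 1)\<close>, and the factor \<open>d ^ (n - j)\<close> of \<open>v j\<close>
  moves it into \<open>I\<close>.\<close>

lemma poly_A_v_taylor:
  assumes "j \<le> n"
  shows "poly_A h f \<odot>\<^bsub>N\<^esub> v j =
    (\<Oplus>\<^bsub>N\<^esub>k\<in>{..j}. scale_A h N (taylor_coeff c f k) (v (j - k)))"
proof -
  let ?t = "\<Sum>k\<le>j. smult (taylor_coeff c f k) (d ^ k)"
  have "d ^ Suc j * d ^ (n - j) dvd (f - ?t) * d ^ (n - j)"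
    by (rule mult_dvd_mono[OF taylor_remainder_dvd[of c, folded d_def]]) simp
  moreover have "d ^ Suc j * d ^ (n - j) = d ^ (n + 1)"
    using assms by (simp flip: power_add power_Suc)
  ultimately have "coset (f * d ^ (n - j)) = coset (?t * d ^ (n - j))"
    by (simp only: coset_eq_iff mem_I_iff left_diff_distrib)
  also have "?t * d ^ (n - j) = (\<Sum>k\<le>j. smult (taylor_coeff c f k) (d ^ (n - (j - k))))"
    unfolding sum_distrib_right using assms
    by (intro sum.cong) (auto simp: add.commute simp flip: power_add)
  finally show ?thesis
    by (simp add: poly_A_v) (simp add: v_def)
qed

lemma basis_v: "basis_A h N (v ` {..n})"
  unfolding basis_A_def
proof (intro conjI)
  show "v ` {..n} \<subseteq> carrier N"
    by (auto simp: v_def)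
  show "lin_indep_A h N (v ` {..n})"
    unfolding lin_indep_A_def
  proof (intro allI impI ballI, elim conjE)
    fix S a b
    assume S: "S \<subseteq> v ` {..n}" "(\<Oplus>\<^bsub>N\<^esub>b\<in>S. scale_A h N (a b) b) = \<zero>\<^bsub>N\<^esub>" and b: "b \<in> S"
    \<comment> \<open>Independence concerns a set of vectors; \<open>J\<close> passes to their
      indices, and the coefficients are then extended by 0 to all of \<open>{..n}\<close>.\<close>
    define J where "J = {j\<in>{..n}. v j \<in> S}"
    have S_eq: "S = v ` J" and inj: "inj_on v J"
      using S(1) inj_v by (auto simp: J_def inj_on_def)
    have "coset 0 = (\<Oplus>\<^bsub>N\<^esub>j\<in>J. scale_A h N (a (v j)) (v j))"
      using S(2) unfolding S_eq
      by (subst (asm) N.finsum_reindex) (auto simp: inj zero_N v_def)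
    also have "\<dots> = coset (\<Sum>j\<in>J. smult (a (v j)) (d ^ (n - j)))"
      by (simp add: v_def J_def)
    also have "(\<Sum>j\<in>J. smult (a (v j)) (d ^ (n - j))) =
        (\<Sum>j\<le>n. smult (if v j \<in> S then a (v j) else 0) (d ^ (n - j)))"
      by (intro sum.mono_neutral_cong_left) (auto simp: J_def)
    finally have "(\<Sum>j\<le>n. smult (if v j \<in> S then a (v j) else 0) (d ^ (n - j))) \<in> I"
      using I_closed(3) by (force simp: coset_eq_iff)
    moreover obtain j where "j \<le> n" "b = v j"
      using S(1) b by auto
    ultimately show "a b = 0"
      using combination_mem_I b by fastforce
  qed
  show "span_A h N (v ` {..n}) = carrier N"
  proof
    show "span_A h N (v ` {..n}) \<subseteq> carrier N"
      by (auto simp: span_A_def v_def intro!: N.finsum_closed)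
    show "carrier N \<subseteq> span_A h N (v ` {..n})"
    proof
      fix w
      assume "w \<in> carrier N"
      then obtain r where w: "w = coset r"
        by (auto simp: carrier_N)
      \<comment> \<open>\<open>span_A\<close> indexes coefficients by vectors, so the index is
        recovered through the inverse of \<open>v\<close>.\<close>
      define e where "e b = taylor_coeff c r (n - the_inv_into {..n} v b)" for b
      \<comment> \<open>The vector \<open>v n\<close> is the class of 1, so \<open>r\<close> acting
        on it gives \<open>w\<close>.\<close>
      have "w = (\<Oplus>\<^bsub>N\<^esub>k\<in>{..n}. scale_A h N (taylor_coeff c r k) (v (n - k)))"
        using poly_A_v_taylor[of n r] by (simp add: poly_A_v w)
      also have "\<dots> = coset (\<Sum>k\<le>n. smult (taylor_coeff c r k) (d ^ (n - (n - k))))"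
        by (simp add: v_def)
      also have "(\<Sum>k\<le>n. smult (taylor_coeff c r k) (d ^ (n - (n - k)))) =
          (\<Sum>j\<le>n. smult (taylor_coeff c r (n - j)) (d ^ (n - j)))"
        by (rule sum.reindex_bij_witness[of _ "\<lambda>j. n - j" "\<lambda>k. n - k"]) auto
      also have "coset \<dots> = (\<Oplus>\<^bsub>N\<^esub>j\<in>{..n}. scale_A h N (taylor_coeff c r (n - j)) (v j))"
        by (simp add: v_def)
      also have "\<dots> = (\<Oplus>\<^bsub>N\<^esub>j\<in>{..n}. scale_A h N (e (v j)) (v j))"
        by (intro N.finsum_cong') (auto simp: e_def the_inv_into_f_f[OF inj_v], auto simp: v_def)
      also have "\<dots> = (\<Oplus>\<^bsub>N\<^esub>b\<in>v ` {..n}. scale_A h N (e b) b)"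
        by (subst N.finsum_reindex) (auto simp: inj_v, auto simp: v_def)
      finally show "w \<in> span_A h N (v ` {..n})"
        unfolding span_A_def by blast
    qed
  qed
qed

lemma has_dimension_N: "has_dimension_A h N (n + 1)"
  unfolding has_dimension_A_def
  using basis_v card_image[OF inj_v] by (intro exI[of _ "v ` {..n}"]) simp

section \<open>Indecomposability\<close>

lemma v_0_nonzero: "v 0 \<noteq> \<zero>\<^bsub>N\<^esub>"
proof
  assume "v 0 = \<zero>\<^bsub>N\<^esub>"
  then have "d ^ Suc n dvd d ^ n"
    by (simp add: v_def zero_N coset_eq_iff mem_I_iff)
  then show False
    using dvd_imp_degree_le[of "d ^ Suc n" "d ^ n"] by (simp del: power_Suc)
qed

lemma v_0_in_submodule:
  assumes U: "submodule U (alg_A h) N" and "U \<noteq> {\<zero>\<^bsub>N\<^esub>}"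
  shows "v 0 \<in> U"
proof -
  interpret U: submodule U "alg_A h" N
    by fact
  have "\<zero>\<^bsub>N\<^esub> \<in> U"
    using U.one_closed by simp
  with assms(2) obtain w where w: "w \<in> U" "w \<noteq> \<zero>\<^bsub>N\<^esub>"
    by auto
  then have "w \<in> carrier N"
    using U.subset by auto
  then obtain r where w_eq: "w = coset r"
    by (auto simp: carrier_N)
  with w have r: "coset r \<in> U" "\<not> d ^ (n + 1) dvd r"
    by (simp_all add: zero_N coset_eq_iff mem_I_iff)
  define m where "m = order c r"
  have "r \<noteq> 0"
    using r(2) by auto
  then obtain s where s: "r = d ^ m * s" "\<not> d dvd s"
    using order_decomp unfolding m_def d_def by blast
  have "m \<le> n"
  proof (rule ccontr)
    assume "\<not> m \<le> n"
    then have "d ^ (n + 1) dvd d ^ m"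
      by (intro le_imp_power_dvd) simp
    with r(2) s(1) show False
      by auto
  qed
  have "poly s c \<noteq> 0"
    using s(2) by (simp add: d_dvd_iff)
  \<comment> \<open>The scalar normalises the value of \<open>s\<close> at \<open>c\<close> to 1, so
    that \<open>f * r\<close> agrees with \<open>d ^ n\<close> modulo
    \<open>d ^ (n + 1)\<close>.\<close>
  define f where "f = smult (inverse (poly s c)) (d ^ (n - m))"
  have "poly_A h f \<odot>\<^bsub>N\<^esub> coset r \<in> U"
    using U.smult_closed[OF _ r(1), of "poly_A h f"] by (simp add: poly_A_def carrier_alg_A)
  then have "coset (f * r) \<in> U"
    by (simp add: poly_A_def)
  moreover have "coset (f * r) = v 0"
  proof -
    have "f * r - d ^ n = d ^ n * (smult (inverse (poly s c)) s - 1)"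
      using \<open>m \<le> n\<close> by (simp add: f_def s(1) algebra_simps flip: power_add)
    moreover have "d dvd smult (inverse (poly s c)) s - 1"
      using \<open>poly s c \<noteq> 0\<close> by (simp add: d_dvd_iff)
    ultimately have "d ^ n * d dvd f * r - d ^ n"
      by (simp only: mult_dvd_mono dvd_refl)
    then show ?thesis
      by (simp add: v_def coset_eq_iff mem_I_iff mult.commute)
  qed
  ultimately show ?thesis
    by simp
qed

text \<open>Two nonzero submodules share the nonzero vector \<open>v 0\<close>, so they cannot
  intersect trivially.\<close>

lemma indecomposable_N: "indecomposable_module (alg_A h) N"
proof -
  have "carrier N \<noteq> {\<zero>\<^bsub>N\<^esub>}"
    using v_0_nonzero coset_in_N[of "d ^ (n - 0)"] unfolding v_def by auto
  moreover have "U = {\<zero>\<^bsub>N\<^esub>} \<or> W = {\<zero>\<^bsub>N\<^esub>}"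
    if "submodule U (alg_A h) N" "submodule W (alg_A h) N" "U \<inter> W = {\<zero>\<^bsub>N\<^esub>}" for U W
    using v_0_in_submodule[OF that(1)] v_0_in_submodule[OF that(2)] that(3) v_0_nonzero by auto
  ultimately show ?thesis
    unfolding indecomposable_module_def using left_module_N by simp
qed

section \<open>The action of the generators on the basis\<close>

lemma gen_x_v:
  assumes "j \<le> n"
  shows "gen_x h \<odot>\<^bsub>N\<^esub> v j =
    scale_A h N c (v j) \<oplus>\<^bsub>N\<^esub> (if j = 0 then \<zero>\<^bsub>N\<^esub> else v (j - 1))"
proof -
  \<comment> \<open>Write \<open>x = c + d\<close>. The last term is \<open>v (j - 1)\<close>, or
    for \<open>j = 0\<close> an element of \<open>I\<close>.\<close>
  have "[:0, 1:] * d ^ (n - j) = smult c (d ^ (n - j)) + d ^ Suc (n - j)"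
    by (simp add: d_def)
  moreover have "v (j - 1) = coset (d ^ Suc (n - j))" if "j \<noteq> 0"
  proof -
    have "n - (j - 1) = Suc (n - j)"
      using that assms by linarith
    then show ?thesis
      by (simp only: v_def)
  qed
  moreover have "coset (smult c (d ^ n) + d ^ Suc n) = coset (smult c (d ^ n))"
    by (simp add: coset_eq_iff mem_I_iff)
  ultimately show ?thesis
    by (simp add: gen_x_def v_def zero_N)
qed

lemma gen_y_v:
  "gen_y h \<odot>\<^bsub>N\<^esub> v j =
    poly_A h q \<odot>\<^bsub>N\<^esub> v j \<oplus>\<^bsub>N\<^esub>
    scale_A h N (of_nat (n - j)) (poly_A h h \<odot>\<^bsub>N\<^esub> v (j + 1))"
proof -
  have "delta h (d ^ (n - j)) = smult (of_nat (n - j)) (h * d ^ (n - (j + 1)))"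
  proof (cases "n - j")
    case (Suc m)
    then have "n - (j + 1) = m"
      by simp
    then show ?thesis
      unfolding delta_def Suc pderiv_power_Suc by (simp add: mult.commute)
  qed (simp add: delta_def)
  then show ?thesis
    by (simp add: gen_y_def poly_A_v) (simp add: v_def)
qed

text \<open>In the expansion of \<open>h\<close> on \<open>v (j + 1)\<close> the term
  \<open>k = 0\<close> has coefficient \<open>h(c) = 0\<close>, so the sum ends at
  \<open>v j\<close>.\<close>

lemma h_v_Suc:
  assumes "j < n"
  shows "poly_A h h \<odot>\<^bsub>N\<^esub> v (j + 1) =
    (\<Oplus>\<^bsub>N\<^esub>l\<in>{..j}. scale_A h N (taylor_coeff c h (j + 1 - l)) (v l))"
proof -
  have "poly_A h h \<odot>\<^bsub>N\<^esub> v (j + 1) =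
      coset (\<Sum>k\<le>Suc j. smult (taylor_coeff c h k) (d ^ (n - (Suc j - k))))"
    using assms by (subst poly_A_v_taylor) (simp_all add: v_def del: sum.atMost_Suc)
  also have "(\<Sum>k\<le>Suc j. smult (taylor_coeff c h k) (d ^ (n - (Suc j - k)))) =
      (\<Sum>k\<le>j. smult (taylor_coeff c h (Suc k)) (d ^ (n - (j - k))))"
    by (simp add: sum.atMost_Suc_shift taylor_coeff_0 root del: sum.atMost_Suc)
  also have "\<dots> = (\<Sum>l\<le>j. smult (taylor_coeff c h (j + 1 - l)) (d ^ (n - l)))"
    by (rule sum.reindex_bij_witness[of _ "\<lambda>l. j - l" "\<lambda>k. j - k"]) (auto simp: Suc_diff_le)
  also have "coset \<dots> = (\<Oplus>\<^bsub>N\<^esub>l\<in>{..j}. scale_A h N (taylor_coeff c h (j + 1 - l)) (v l))"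
    by (simp add: v_def)
  finally show ?thesis .
qed

lemma scale_0_N: "w \<in> carrier N \<Longrightarrow> scale_A h N 0 w = \<zero>\<^bsub>N\<^esub>"
  by (auto simp: carrier_N zero_N)

end

theorem proposition3p2:
  fixes h q :: "'a::field poly" and c :: 'a and n :: nat
  assumes "h \<noteq> 0"
    and "\<not> (\<exists>a. a \<noteq> 0 \<and> h = [:a:])"
    and "poly h c = 0"
  defines "N \<equiv> module_N h (PIdl\<^bsub>ring_of_type_algebra\<^esub> ([:- c, 1:] ^ (n + 1))) q"
  shows "indecomposable_module (alg_A h) N \<and>
    has_dimension_A h N (n + 1) \<and>
    (\<exists>v. inj_on v {..n} \<and> basis_A h N (v ` {..n}) \<and>
      (\<forall>j\<le>n.
        gen_x h \<odot>\<^bsub>N\<^esub> v j =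
          scale_A h N c (v j) \<oplus>\<^bsub>N\<^esub> (if j = 0 then \<zero>\<^bsub>N\<^esub> else v (j - 1)) \<and>
        gen_y h \<odot>\<^bsub>N\<^esub> v j =
          poly_A h q \<odot>\<^bsub>N\<^esub> v j \<oplus>\<^bsub>N\<^esub>
          (if j = n then \<zero>\<^bsub>N\<^esub>
           else scale_A h N (of_nat (n - j)) (poly_A h h \<odot>\<^bsub>N\<^esub> v (j + 1))) \<and>
        gen_y h \<odot>\<^bsub>N\<^esub> v j =
          poly_A h q \<odot>\<^bsub>N\<^esub> v j \<oplus>\<^bsub>N\<^esub>
          scale_A h N (of_nat (n - j))
            (\<Oplus>\<^bsub>N\<^esub>l\<in>{..j}. scale_A h N (taylor_coeff c h (j + 1 - l)) (v l)) \<and>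
        (\<forall>f. poly_A h f \<odot>\<^bsub>N\<^esub> v j =
          (\<Oplus>\<^bsub>N\<^esub>k\<in>{..j}. scale_A h N (taylor_coeff c f k) (v (j - k))))))"
proof -
  interpret P: linear_power_ideal h q c n
    by standard (rule assms)
  have N_eq: "N = module_N h P.I q"
    by (simp only: N_def P.I_def P.d_def)
  have y: "gen_y h \<odot>\<^bsub>N\<^esub> P.v j = poly_A h q \<odot>\<^bsub>N\<^esub> P.v j \<oplus>\<^bsub>N\<^esub>
      (if j = n then \<zero>\<^bsub>N\<^esub>
       else scale_A h N (of_nat (n - j)) (poly_A h h \<odot>\<^bsub>N\<^esub> P.v (j + 1)))" for j
    unfolding N_eq P.gen_y_v by (auto simp: P.poly_A_v P.scale_0_N simp del: P.scale_N)
  \<comment> \<open>For \<open>j = n\<close> the scalar \<open>n - j\<close> is 0 and annihilates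
    the sum, which only has to lie in the carrier; for \<open>j < n\<close> the two forms agree by
    \<open>h_v_Suc\<close>.\<close>
  have eta: "(if j = n then \<zero>\<^bsub>N\<^esub>
       else scale_A h N (of_nat (n - j)) (poly_A h h \<odot>\<^bsub>N\<^esub> P.v (j + 1))) =
      scale_A h N (of_nat (n - j))
        (\<Oplus>\<^bsub>N\<^esub>l\<in>{..j}. scale_A h N (taylor_coeff c h (j + 1 - l)) (P.v l))" if "j \<le> n" for j
  proof (cases "j = n")
    case True
    have "(\<Oplus>\<^bsub>N\<^esub>l\<in>{..j}. scale_A h N (taylor_coeff c h (j + 1 - l)) (P.v l)) \<in> carrier N"
      by (simp add: N_eq P.v_def)
    with True show ?thesis
      by (simp add: N_eq P.scale_0_N)
  next
    case False
    with that have "j < n"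
      by simp
    with False show ?thesis
      by (simp only: N_eq P.h_v_Suc if_False)
  qed
  show ?thesis
    using P.indecomposable_N P.has_dimension_N P.inj_v P.basis_v P.gen_x_v P.poly_A_v_taylor y eta
    unfolding N_eq by (intro conjI exI[of _ P.v] allI impI) auto
qed

end
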